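(* Let $n\ge 2$ and let $\Delta_{n-1}=\{x\in\mathbb{R}^n : x_i\ge 0,\ \sum_{i=1}^n x_i=1\}$ be the set of rent divisions of an apartment with rooms $1,\dots,n$ (room $i$ costs the fraction $x_i$ of the total rent). For each $j\in\{1,\dots,n-1\}$ let $P_j$ assign to every $x\in\Delta_{n-1}$ a set $P_j(x)\subseteq\{1,\dots,n\}$ (the rooms roommate $j$ finds acceptable at $x$) such that: (1) $P_j(x)\neq\emptyset$ for every $x\in\Delta_{n-1}$; (2) whenever $x$ has at least one zero coordinate, $P_j(x)=\{i : x_i=0\}$ (each person prefers a free room to a non-free room and is indifferent among free rooms). Then for every $\varepsilon>0$ there is a finite set $S\subseteq\Delta_{n-1}$ of diameter less than $\varepsilon$ (in fact the vertex set of a simplex of a triangulation of $\Delta_{n-1}$) such that for every room $r\in\{1,\dots,n\}$ (the room chosen by an $n$-th roommate whose preferences are unknown) there is a bijection $\phi:\{1,\dots,n-1\}\to\{1,\dots,n\}\setminus\{r\}$ such that for every $j\in\{1,\dots,n-1\}$ there is $y\in S$ with $\phi(j)\in P_j(y)$.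
   Context: This is the precise form of the statement "for an $n$-bedroom apartment it is sufficient to know the subjective preferences of $n-1$ roommates to find an envy-free division of rent." The modelling assumption is that roommates do not care about small (e.g. one-cent) error margins: rent divisions within distance $\varepsilon$ of one another are regarded as the same division, so a room acceptable to a roommate at some point of $S$ is regarded as acceptable at the chosen (approximate) division. An envy-free division is one in which the rooms can be assigned bijectively to the roommates so that each receives an acceptable room; the conclusion says this is possible whatever room the $n$-th roommate picks. *)

theory Defs
  imports "HOL-Analysis.Analysis"
begin

text \<open>The rooms are the elements of the finite type \<open>'n\<close>; a rent division lists the fraction of the
  total rent charged for each room.\<close>

definition rent_divisions :: "(real ^ 'n::finite) set" where
  "rent_divisions = {x. (\<forall>i. 0 \<le> x $ i) \<and> (\<Sum>i\<in>UNIV. x $ i) = 1}"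

text \<open>Simplices of all dimensions belong to the triangulation: unlike the library's
  \<open>triangulation\<close>, a \<open>simplicial_complex\<close> is closed under taking faces.\<close>

definition triangulates :: "'a::euclidean_space set set \<Rightarrow> 'a set \<Rightarrow> bool" where
  "triangulates \<T> X \<longleftrightarrow> simplicial_complex \<T> \<and> \<Union>\<T> = X"

end

theory Submission
  imports Defs
begin

text \<open>Choose an acceptable room at every vertex of a fine triangulation for each of the \<open>m = n - 1\<close>
  known roommates, average the corresponding unit vectors over the roommates, and extend to a
  piecewise affine map \<open>f\<close>. By Brouwer's theorem \<open>f\<close> attains the barycentre, say in the simplex \<open>K\<close>.
  The barycentric coordinates then make up an \<open>n \<times> m\<close> matrix of nonnegative weights (room,
  roommate), supported on the rooms acceptable at some vertex of \<open>K\<close>, with all column sums \<open>1\<close> and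
  all row sums \<open>m / n < 1\<close>. Hence any \<open>k > 0\<close> roommates accept more than \<open>k\<close> rooms altogether, so
  that Hall's condition survives the removal of an arbitrary room.\<close>

section \<open>Hall's marriage theorem\<close>

text \<open>The Halmos-Vaughan induction. If some nonempty proper \<open>J\<close> is tight,
  \<open>J\<close> and its complement are matched separately; otherwise every nonempty proper subset
  has a surplus and one pair can be fixed arbitrarily.\<close>

theorem Hall_marriage:
  assumes "finite I" "\<And>i. i \<in> I \<Longrightarrow> finite (A i)"
    and "\<And>J. J \<subseteq> I \<Longrightarrow> card J \<le> card (\<Union>(A ` J))"
  shows "\<exists>\<phi>. inj_on \<phi> I \<and> (\<forall>i\<in>I. \<phi> i \<in> A i)"
  using assms
proof (induction "card I" arbitrary: I A rule: less_induct)
  case less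
  note fin = less.prems(1,2) and Hall = less.prems(3)
  show ?case
  proof (cases "I = {}")
    case False
    then obtain a where a: "a \<in> I" by blast
    show ?thesis
    proof (cases "\<exists>J. J \<subset> I \<and> J \<noteq> {} \<and> card (\<Union>(A ` J)) = card J")
      case True
      then obtain J where J: "J \<subset> I" "J \<noteq> {}" "card (\<Union>(A ` J)) = card J" by blast
      define B where "B = \<Union>(A ` J)"
      have finJ: "finite J" using J(1) fin(1) finite_subset by blast
      have "card J < card I" using J(1) fin(1) psubset_card_mono by blast
      then have "\<exists>\<phi>. inj_on \<phi> J \<and> (\<forall>j\<in>J. \<phi> j \<in> A j)"
        by (rule less.hyps) (use J(1) fin Hall finJ in blast)+
      then obtain \<phi> where \<phi>: "inj_on \<phi> J" "\<And>j. j \<in> J \<Longrightarrow> \<phi> j \<in> A j"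
        by blast
      have "card (I - J) < card I"
        using J(1,2) fin(1) by (intro psubset_card_mono) auto
      \<comment> \<open>Hall's condition survives the deletion of \<open>B\<close>: it is applied to
        \<open>L\<close> together with \<open>J\<close>, and the share of \<open>J\<close> cancels
        because \<open>J\<close> is tight.\<close>
      moreover have "card L \<le> card (\<Union>((\<lambda>i. A i - B) ` L))" if L: "L \<subseteq> I - J" for L
      proof -
        have finL: "finite L" using L fin(1) finite_subset by blast
        have "card L + card J = card (L \<union> J)"
          using L finJ finL by (subst card_Un_disjoint) auto
        also have "\<dots> \<le> card (\<Union>(A ` (L \<union> J)))"
          using L J(1) by (intro Hall) auto
        also have "\<Union>(A ` (L \<union> J)) = \<Union>((\<lambda>i. A i - B) ` L) \<union> B"
          unfolding B_def by auto
        also have "card \<dots> \<le> card (\<Union>((\<lambda>i. A i - B) ` L)) + card B"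
          by (rule card_Un_le)
        finally show ?thesis using J(3) unfolding B_def by simp
      qed
      ultimately obtain \<psi> where \<psi>: "inj_on \<psi> (I - J)" "\<And>j. j \<in> I - J \<Longrightarrow> \<psi> j \<in> A j - B"
        using less.hyps[of "I - J" "\<lambda>i. A i - B"] fin by (metis Diff_iff finite_Diff)
      define \<theta> where "\<theta> i = (if i \<in> J then \<phi> i else \<psi> i)" for i
      \<comment> \<open>Values on \<open>J\<close> lie in \<open>B\<close> and values off
        \<open>J\<close> avoid it, so the two matchings cannot collide.\<close>
      have inB: "\<theta> i \<in> B \<longleftrightarrow> i \<in> J" if "i \<in> I" for i
        using \<phi>(2) \<psi>(2) that unfolding \<theta>_def B_def by auto
      have "inj_on \<theta> I"
      proof (rule inj_onI)
        fix i j assume ij: "i \<in> I" "j \<in> I" "\<theta> i = \<theta> j"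
        then have "i \<in> J \<longleftrightarrow> j \<in> J" using inB by metis
        then show "i = j"
          using ij \<phi>(1) \<psi>(1) unfolding \<theta>_def inj_on_def by (auto split: if_splits)
      qed
      moreover have "\<forall>i\<in>I. \<theta> i \<in> A i"
        using \<phi>(2) \<psi>(2) unfolding \<theta>_def by auto
      ultimately show ?thesis by blast
    next
      case False
      have "card {a} \<le> card (\<Union>(A ` {a}))" using a by (intro Hall) auto
      then obtain b where b: "b \<in> A a" by fastforce
      have lt: "card (I - {a}) < card I" using a fin(1) by (meson card_Diff1_less)
      \<comment> \<open>No nonempty proper subset is tight, so the surplus of \<open>L\<close> pays
        for the loss of \<open>b\<close>.\<close>
      have "card L \<le> card (\<Union>((\<lambda>i. A i - {b}) ` L))" if L: "L \<subseteq> I - {a}" for L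
      proof (cases "L = {}")
        case nonempty: False
        have "L \<subset> I" using L a by blast
        then have "card L < card (\<Union>(A ` L))"
          using False nonempty Hall[of L] by (metis le_neq_implies_less psubset_imp_subset)
        also have "\<dots> \<le> card (\<Union>(A ` L) - {b}) + 1"
          using diff_card_le_card_Diff[of "{b}" "\<Union>(A ` L)"] by simp
        also have "\<Union>(A ` L) - {b} = \<Union>((\<lambda>i. A i - {b}) ` L)" by auto
        finally show ?thesis by simp
      qed simp
      then obtain \<psi> where \<psi>: "inj_on \<psi> (I - {a})" "\<And>j. j \<in> I - {a} \<Longrightarrow> \<psi> j \<in> A j - {b}"
        using less.hyps[OF lt, of "\<lambda>i. A i - {b}"] fin by (metis Diff_iff finite_Diff)
      have "inj_on (\<psi>(a := b)) I"
        using \<psi> by (auto simp: inj_on_def)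
      moreover have "\<forall>i\<in>I. (\<psi>(a := b)) i \<in> A i"
        using \<psi>(2) b by auto
      ultimately show ?thesis by blast
    qed
  qed simp
qed

section \<open>Piecewise affine maps on simplicial complexes\<close>

text \<open>Translation by a point of \<open>C\<close> turns affine into linear independence, and
  linear maps extend from independent sets. Arbitrary subsets \<open>D\<close> are allowed so that
  the formula can be read on faces of a simplex.\<close>

lemma affine_interpolation:
  fixes g :: "'a::euclidean_space \<Rightarrow> 'b::real_normed_vector"
  assumes "\<not> affine_dependent C"
  shows "\<exists>h. continuous_on UNIV h \<and>
    (\<forall>D u. D \<subseteq> C \<and> sum u D = 1 \<longrightarrow> h (\<Sum>v\<in>D. u v *\<^sub>R v) = (\<Sum>v\<in>D. u v *\<^sub>R g v))"
proof (cases "C = {}")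
  case False
  then obtain a where a: "a \<in> C" by blast
  have "independent ((\<lambda>x. -a + x) ` (C - {a}))"
    using assms affine_dependent_iff_dependent2[OF a] by blast
  from linear_independent_extend[OF this, of "\<lambda>y. g (a + y) - g a"]
  obtain l where l: "linear l" "\<And>v. v \<in> C - {a} \<Longrightarrow> l (v - a) = g v - g a"
    by (auto simp: algebra_simps)
  define h where "h x = l (x - a) + g a" for x
  have hv: "h v = g v" if "v \<in> C" for v
    using l that linear_0[OF l(1)] unfolding h_def by (cases "v = a") auto
  have "h (\<Sum>v\<in>D. u v *\<^sub>R v) = (\<Sum>v\<in>D. u v *\<^sub>R g v)" if D: "D \<subseteq> C" "sum u D = 1" for D u
  proof -
    \<comment> \<open>Weights of sum 1 let the translation by \<open>a\<close> and the constant
      \<open>g a\<close> move inside the sum.\<close>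
    have a_eq: "a = (\<Sum>v\<in>D. u v *\<^sub>R a)" and ga_eq: "g a = (\<Sum>v\<in>D. u v *\<^sub>R g a)"
      using D(2) by (simp_all flip: scaleR_left.sum)
    have "h (\<Sum>v\<in>D. u v *\<^sub>R v) = l (\<Sum>v\<in>D. u v *\<^sub>R (v - a)) + g a"
      unfolding h_def by (subst a_eq) (simp add: sum_subtractf scaleR_diff_right)
    also have "\<dots> = (\<Sum>v\<in>D. u v *\<^sub>R l (v - a)) + g a"
      by (simp add: linear_sum[OF l(1)] linear_cmul[OF l(1)])
    also have "\<dots> = (\<Sum>v\<in>D. u v *\<^sub>R h v)"
      by (subst ga_eq) (simp add: h_def sum.distrib scaleR_add_right)
    also have "\<dots> = (\<Sum>v\<in>D. u v *\<^sub>R g v)"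
      using hv D(1) by (intro sum.cong) auto
    finally show ?thesis .
  qed
  moreover have "continuous_on UNIV h"
    unfolding h_def using l(1)
    by (intro continuous_intros linear_continuous_on_compose) auto
  ultimately show ?thesis by blast
\<comment> \<open>For empty \<open>C\<close> the requirement is vacuous, as an empty sum is not
  1.\<close>
qed (auto intro!: exI[of _ "\<lambda>_. 0"])

lemma simplicial_complex_simplex:
  assumes "simplicial_complex \<T>" "K \<in> \<T>"
  shows "finite {v. v extreme_point_of K}" "\<not> affine_dependent {v. v extreme_point_of K}"
    "K = convex hull {v. v extreme_point_of K}"
proof -
  obtain C where C: "\<not> affine_dependent C" "K = convex hull C"
    using assms unfolding simplicial_complex_def simplex_def by meson
  then have "{v. v extreme_point_of K} = C"
    using extreme_point_of_convex_hull_affine_independent by auto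
  then show "finite {v. v extreme_point_of K}" "\<not> affine_dependent {v. v extreme_point_of K}"
    "K = convex hull {v. v extreme_point_of K}"
    using C aff_independent_finite by auto
qed

text \<open>Each simplex is interpolated separately. Two simplices meet in a common face whose
  vertices are vertices of both, so both interpolations are determined there by \<open>g\<close>;
  finitely many closed pieces then glue continuously.\<close>

lemma piecewise_affine_extension:
  fixes g :: "'a::euclidean_space \<Rightarrow> 'b::real_normed_vector"
  assumes T: "simplicial_complex \<T>"
  shows "\<exists>f. continuous_on (\<Union>\<T>) f \<and>
    (\<forall>K u. K \<in> \<T> \<and> (\<forall>v. v extreme_point_of K \<longrightarrow> 0 \<le> u v) \<and> sum u {v. v extreme_point_of K} = 1
      \<longrightarrow> f (\<Sum>v | v extreme_point_of K. u v *\<^sub>R v) = (\<Sum>v | v extreme_point_of K. u v *\<^sub>R g v))"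
proof -
  define V where "V K = {v::'a. v extreme_point_of K}" for K
  note V = simplicial_complex_simplex[OF T, folded V_def]
  have "\<forall>K\<in>\<T>. \<exists>h. continuous_on UNIV h \<and>
    (\<forall>D u. D \<subseteq> V K \<and> sum u D = 1 \<longrightarrow> h (\<Sum>v\<in>D. u v *\<^sub>R v) = (\<Sum>v\<in>D. u v *\<^sub>R g v))"
    using affine_interpolation[OF V(2)] by blast
  then obtain h where h: "\<And>K. K \<in> \<T> \<Longrightarrow> continuous_on UNIV (h K)"
    "\<And>K D u. K \<in> \<T> \<Longrightarrow> D \<subseteq> V K \<Longrightarrow> sum u D = 1 \<Longrightarrow>
       h K (\<Sum>v\<in>D. u v *\<^sub>R v) = (\<Sum>v\<in>D. u v *\<^sub>R g v)"
    unfolding bchoice_iff by blast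
  have Int_face: "K \<inter> L face_of K" if "K \<in> \<T>" "L \<in> \<T>" for K L
    using T that unfolding simplicial_complex_def by blast
  have agree: "h K x = h L x" if KL: "K \<in> \<T>" "L \<in> \<T>" and x: "x \<in> K" "x \<in> L" for K L x
  proof -
    have face: "K \<inter> L face_of K" "K \<inter> L face_of L"
      using Int_face[OF KL] Int_face[OF KL(2,1)] by (simp_all add: Int_commute)
    then have M: "K \<inter> L \<in> \<T>"
      using T KL unfolding simplicial_complex_def by blast
    have sub: "V (K \<inter> L) \<subseteq> V K" "V (K \<inter> L) \<subseteq> V L"
      using face extreme_point_of_face unfolding V_def by blast+
    \<comment> \<open>Barycentric coordinates over the common face serve in both simplices at
      once.\<close>
    have "x \<in> convex hull (V (K \<inter> L))" using x V(3)[OF M] by blast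
    then obtain u where u: "sum u (V (K \<inter> L)) = 1" "(\<Sum>v\<in>V (K \<inter> L). u v *\<^sub>R v) = x"
      unfolding convex_hull_finite[OF V(1)[OF M]] by auto
    show ?thesis
      using h(2)[OF KL(1) sub(1) u(1)] h(2)[OF KL(2) sub(2) u(1)] u(2) by simp
  qed
  \<comment> \<open>By \<open>agree\<close> the choice of the simplex does not affect the
    value.\<close>
  define f where "f x = h (SOME K. K \<in> \<T> \<and> x \<in> K) x" for x
  have f_eq: "f x = h K x" if "K \<in> \<T>" "x \<in> K" for K x
  proof -
    have "(SOME K. K \<in> \<T> \<and> x \<in> K) \<in> \<T> \<and> x \<in> (SOME K. K \<in> \<T> \<and> x \<in> K)"
      by (rule someI[of _ K]) (use that in blast)
    then show ?thesis unfolding f_def by (intro agree that) auto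
  qed
  have "continuous_on (\<Union>K\<in>\<T>. K) f"
  proof (rule continuous_on_closed_Union)
    show "finite \<T>" using T unfolding simplicial_complex_def by blast
    show "closed K" if "K \<in> \<T>" for K
      using T that closed_simplex unfolding simplicial_complex_def by blast
    show "continuous_on K f" if "K \<in> \<T>" for K
      by (rule continuous_on_eq[OF continuous_on_subset[OF h(1)[OF that] subset_UNIV]])
         (simp add: f_eq[OF that])
  qed
  moreover have "f (\<Sum>v\<in>V K. u v *\<^sub>R v) = (\<Sum>v\<in>V K. u v *\<^sub>R g v)"
    if K: "K \<in> \<T>" and u: "\<forall>v. v extreme_point_of K \<longrightarrow> 0 \<le> u v" "sum u (V K) = 1" for K u
  proof -
    have "(\<Sum>v\<in>V K. u v *\<^sub>R v) \<in> convex hull (V K)"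
      unfolding convex_hull_finite[OF V(1)[OF K]] using u unfolding V_def by blast
    then have "(\<Sum>v\<in>V K. u v *\<^sub>R v) \<in> K" using V(3)[OF K] by blast
    from f_eq[OF K this] show ?thesis using h(2)[OF K subset_refl u(2)] by simp
  qed
  ultimately show ?thesis unfolding V_def by auto
qed

section \<open>Brouwer's theorem on the simplex of rent divisions\<close>

lemma rent_divisions_eq_hull:
  "(rent_divisions :: (real ^ 'n::finite) set) = convex hull (range (\<lambda>i. axis i 1))"
proof
  show "(rent_divisions :: (real ^ 'n) set) \<subseteq> convex hull (range (\<lambda>i. axis i 1))"
  proof
    fix x :: "real ^ 'n" assume x: "x \<in> rent_divisions"
    have "x = (\<Sum>i\<in>UNIV. x $ i *\<^sub>R axis i 1)"
      by (simp add: vec_eq_iff axis_def if_distrib cong: if_cong)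
    also have "\<dots> \<in> convex hull (range (\<lambda>i. axis i 1))"
      using x unfolding rent_divisions_def
      by (intro convex_sum) (auto simp: hull_inc)
    finally show "x \<in> convex hull (range (\<lambda>i. axis i 1))" .
  qed
  have "convex (rent_divisions :: (real ^ 'n) set)"
    unfolding convex_def rent_divisions_def
    by (auto simp: sum.distrib simp flip: sum_distrib_left)
  then show "convex hull (range (\<lambda>i. axis i 1)) \<subseteq> (rent_divisions :: (real ^ 'n) set)"
    by (intro hull_minimal) (auto simp: rent_divisions_def axis_def)
qed

lemma polytope_rent_divisions: "polytope (rent_divisions :: (real ^ 'n::finite) set)"
  unfolding rent_divisions_eq_hull by (simp add: polytope_convex_hull)

text \<open>Writing \<open>c\<close> for the barycentre, a fixed point \<open>x\<close> of \<open>x \<mapsto> closest_point (x + (f x - c))\<close>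
  maximises the linear functional \<open>y \<mapsto> (f x - c) \<bullet> y\<close>; shifting rent between two rooms shows that
  \<open>f x - c\<close> is largest on the support of \<open>x\<close>.\<close>

lemma ex_uniform_value:
  fixes f :: "real ^ 'n::finite \<Rightarrow> real ^ 'n"
  assumes cont: "continuous_on rent_divisions f"
    and sum1: "\<And>x. x \<in> rent_divisions \<Longrightarrow> (\<Sum>i\<in>UNIV. f x $ i) = 1"
    and bdry: "\<And>x. x \<in> rent_divisions \<Longrightarrow> \<exists>i. x $ i = 0 \<Longrightarrow>
      \<exists>k. 0 < x $ k \<and> f x $ k < 1 / CARD('n)"
  shows "\<exists>x\<in>rent_divisions. \<forall>i. f x $ i = 1 / CARD('n)"
proof -
  let ?\<Delta> = "rent_divisions :: (real ^ 'n) set"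
  let ?p = "\<lambda>x. closest_point ?\<Delta> (x + (f x - (\<chi> i. 1 / CARD('n))))"
  have comp: "compact ?\<Delta>" and conv: "convex ?\<Delta>" and ne: "?\<Delta> \<noteq> {}"
    using polytope_imp_compact[OF polytope_rent_divisions] polytope_imp_convex[OF polytope_rent_divisions]
    by (simp_all add: rent_divisions_eq_hull)
  have clo: "closed ?\<Delta>" using comp compact_imp_closed by blast
  have "continuous_on ?\<Delta> ?p"
    by (rule continuous_on_compose2[OF continuous_on_closest_point[OF conv clo ne, of UNIV]])
       (auto intro!: continuous_intros cont)
  moreover have "?p \<in> ?\<Delta> \<rightarrow> ?\<Delta>"
    using closest_point_in_set[OF clo ne] by blast
  ultimately obtain x where x: "x \<in> ?\<Delta>" "?p x = x"
    using brouwer[OF comp conv ne] by blast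
  define w where "w = f x - (\<chi> i. 1 / CARD('n))"
  have w_sum: "(\<Sum>i\<in>UNIV. w $ i) = 0"
    using sum1[OF x(1)] unfolding w_def by (simp add: sum_subtractf)
  have w_max: "w $ i \<le> w $ k" if k: "0 < x $ k" for i k
  proof -
    define y where "y = x + x $ k *\<^sub>R (axis i 1 - axis k 1)"
    have "0 \<le> y $ j" for j
      using x(1) k unfolding y_def rent_divisions_def by (auto simp: axis_def)
    moreover have "(\<Sum>j\<in>UNIV. y $ j) = 1"
      using x(1) unfolding y_def rent_divisions_def
      by (simp add: axis_def sum.distrib sum_subtractf flip: sum_distrib_left)
    ultimately have "y \<in> ?\<Delta>" unfolding rent_divisions_def by blast
    from closest_point_dot[OF conv clo this, of "x + w"]
    have "w \<bullet> (y - x) \<le> 0" using x(2) unfolding w_def by simp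
    then have "x $ k * (w $ i - w $ k) \<le> 0"
      unfolding y_def by (simp add: inner_diff_right inner_axis)
    then show ?thesis using k by (simp add: mult_le_0_iff)
  qed
  \<comment> \<open>If a coordinate of \<open>x\<close> vanished, \<open>bdry\<close> would give a
    room \<open>k\<close> in the support with \<open>w $ k\<close> negative; by \<open>w_max\<close>
    this entry is the largest, so all entries would be negative although they sum to zero.\<close>
  have pos: "0 < x $ i" for i
  proof (rule ccontr)
    assume "\<not> 0 < x $ i"
    then have "x $ i = 0" using x(1) unfolding rent_divisions_def
      by (simp add: order.antisym)
    then obtain k where k: "0 < x $ k" "f x $ k < 1 / CARD('n)" using bdry[OF x(1)] by blast
    then have "w $ j < 0" for j using w_max[OF k(1), of j] unfolding w_def by simp
    then have "(\<Sum>j\<in>UNIV. w $ j) < 0" using sum_strict_mono[of UNIV "\<lambda>j. w $ j" "\<lambda>_. 0"] by simp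
    then show False using w_sum by simp
  qed
  \<comment> \<open>The support being full, \<open>w_max\<close> applies in both directions, so
    \<open>w\<close> is constant.\<close>
  have "w $ i = 0" for i
  proof -
    have "w $ j = w $ i" for j by (intro order.antisym w_max pos)
    then have "(\<Sum>j\<in>UNIV. w $ j) = (\<Sum>j\<in>(UNIV :: 'n set). w $ i)" by (intro sum.cong) auto
    then show ?thesis using w_sum by simp
  qed
  then show ?thesis using x(1) unfolding w_def by auto
qed

text \<open>Provides a room whose price stays positive throughout any simplex around
  \<open>x\<close> of diameter below 1/n.\<close>

lemma ex_coordinate_ge:
  fixes x :: "real ^ 'n::finite"
  assumes "x \<in> rent_divisions"
  shows "\<exists>k. 1 / CARD('n) \<le> x $ k"
proof (rule ccontr)
  assume "\<not> ?thesis"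
  then have "(\<Sum>k\<in>UNIV. x $ k) < (\<Sum>k\<in>(UNIV :: 'n set). 1 / CARD('n))"
    by (intro sum_strict_mono) (auto simp: not_le)
  then show False using assms unfolding rent_divisions_def by simp
qed

section \<open>A simplex with balanced room labels\<close>

text \<open>Each \<open>l j\<close> labels points by rooms, and \<open>u\<close> consists of the
  barycentric coordinates of a point that the averaged labelling sends to the barycentre. The
  diameter bound and \<open>free\<close> together give the boundary condition of
  \<open>ex_uniform_value\<close>.\<close>

lemma ex_balanced_simplex:
  fixes l :: "nat \<Rightarrow> real ^ 'n::finite \<Rightarrow> 'n"
  assumes T: "simplicial_complex \<T>" "\<Union>\<T> = (rent_divisions :: (real ^ 'n) set)"
    and diam: "\<And>K. K \<in> \<T> \<Longrightarrow> diameter K < 1 / CARD('n)"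
    and m: "0 < m"
    and free: "\<And>j v. j \<in> {1..m} \<Longrightarrow> v \<in> rent_divisions \<Longrightarrow> \<exists>i. v $ i = 0 \<Longrightarrow> v $ l j v = 0"
  shows "\<exists>K\<in>\<T>. \<exists>u. (\<forall>v. v extreme_point_of K \<longrightarrow> 0 \<le> u v) \<and> sum u {v. v extreme_point_of K} = 1 \<and>
    (\<forall>i. (\<Sum>j=1..m. \<Sum>v | v extreme_point_of K \<and> l j v = i. u v) = m / CARD('n))"
proof -
  let ?\<Delta> = "rent_divisions :: (real ^ 'n) set"
  define V where "V K = {v :: real ^ 'n. v extreme_point_of K}" for K
  note V = simplicial_complex_simplex[OF T(1), folded V_def]
  define g where "g v = (\<chi> i. (\<Sum>j=1..m. of_bool (l j v = i)) / real m)" for v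
  have g_sum: "(\<Sum>i\<in>UNIV. g v $ i) = 1" for v
  proof -
    have "(\<Sum>i\<in>UNIV. \<Sum>j=1..m. of_bool (l j v = i) :: real) = (\<Sum>j=1..m. \<Sum>i\<in>UNIV. of_bool (l j v = i))"
      by (rule sum.swap)
    then show ?thesis using m unfolding g_def by (simp flip: sum_divide_distrib)
  qed
  obtain f where f: "continuous_on ?\<Delta> f"
    "\<And>K u. K \<in> \<T> \<Longrightarrow> (\<And>v. v \<in> V K \<Longrightarrow> 0 \<le> u v) \<Longrightarrow> sum u (V K) = 1 \<Longrightarrow>
       f (\<Sum>v\<in>V K. u v *\<^sub>R v) = (\<Sum>v\<in>V K. u v *\<^sub>R g v)"
    using piecewise_affine_extension[OF T(1), of g] unfolding T(2) V_def by auto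
  have VK: "V K \<subseteq> K" "K \<subseteq> ?\<Delta>" if "K \<in> \<T>" for K
    using that T(2) unfolding V_def extreme_point_of_def by auto
  have coords: "\<exists>K u. K \<in> \<T> \<and> x \<in> K \<and> (\<forall>v\<in>V K. 0 \<le> u v) \<and> sum u (V K) = 1 \<and> x = (\<Sum>v\<in>V K. u v *\<^sub>R v)
      \<and> f x = (\<Sum>v\<in>V K. u v *\<^sub>R g v)" if x: "x \<in> ?\<Delta>" for x
  proof -
    obtain K where K: "K \<in> \<T>" "x \<in> K" using x T(2) by blast
    then have "x \<in> convex hull (V K)" using V(3) by metis
    then obtain u where "\<forall>v\<in>V K. 0 \<le> u v" "sum u (V K) = 1" "(\<Sum>v\<in>V K. u v *\<^sub>R v) = x"
      unfolding convex_hull_finite[OF V(1)[OF K(1)]] by blast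
    then show ?thesis using K f(2)[OF K(1), of u] by blast
  qed
  have "\<exists>x\<in>?\<Delta>. \<forall>i. f x $ i = 1 / CARD('n)"
  proof (rule ex_uniform_value[OF f(1)])
    fix x :: "real ^ 'n" assume x: "x \<in> ?\<Delta>"
    from coords[OF x] obtain K u where K: "K \<in> \<T>" "x \<in> K"
      and u: "\<And>v. v \<in> V K \<Longrightarrow> 0 \<le> u v" "sum u (V K) = 1"
      and xe: "x = (\<Sum>v\<in>V K. u v *\<^sub>R v)" and fe: "f x = (\<Sum>v\<in>V K. u v *\<^sub>R g v)"
      by blast
    have "(\<Sum>i\<in>UNIV. f x $ i) = (\<Sum>v\<in>V K. \<Sum>i\<in>UNIV. u v * g v $ i)"
      unfolding fe by (simp add: sum.swap[of _ UNIV])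
    then show "(\<Sum>i\<in>UNIV. f x $ i) = 1"
      using u(2) by (simp add: g_sum flip: sum_distrib_left)
    assume "\<exists>i. x $ i = 0"
    then obtain i where i: "x $ i = 0" by blast
    \<comment> \<open>This \<open>k\<close> witnesses the boundary condition, with
      \<open>f x $ k\<close> even zero: no vertex of positive weight carries the label
      \<open>k\<close>.\<close>
    obtain k where k: "1 / CARD('n) \<le> x $ k" using ex_coordinate_ge[OF x] by blast
    have "u v * g v $ k = 0" if v: "v \<in> V K" for v
    proof (cases "u v = 0")
      case False
      have v\<Delta>: "v \<in> ?\<Delta>" using v VK[OF K(1)] by blast
      \<comment> \<open>The zero \<open>x $ i\<close> is a sum of nonnegative terms, so vertices of
        positive weight lie on the face where room \<open>i\<close> is free and their labels are
        free rooms; room \<open>k\<close> is not free there, by the diameter bound.\<close>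
      have "0 \<le> u v * v $ i" if "v \<in> V K" for v
        using u(1) VK[OF K(1)] that unfolding rent_divisions_def by auto
      moreover have "(\<Sum>v\<in>V K. u v * v $ i) = 0" using i xe by simp
      ultimately have "u v * v $ i = 0"
        using sum_nonneg_0[OF V(1)[OF K(1)] _ _ v, of "\<lambda>v. u v * v $ i"] by blast
      then have "v $ i = 0" using False by simp
      moreover have "v $ k \<noteq> 0"
      proof -
        have "bounded K"
          using V(3)[OF K(1)] V(1)[OF K(1)] by (metis bounded_convex_hull finite_imp_bounded)
        then have "dist x v < 1 / CARD('n)"
          using diameter_bounded_bound[of K x v] diam[OF K(1)] K(2) v VK[OF K(1)] by fastforce
        moreover have "\<bar>x $ k - v $ k\<bar> \<le> dist x v"
          using component_le_norm_cart[of "x - v" k] by (simp add: dist_norm)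
        ultimately show ?thesis using k by auto
      qed
      ultimately have "l j v \<noteq> k" if "j \<in> {1..m}" for j
        using free[OF that v\<Delta>] by metis
      then show ?thesis unfolding g_def by (auto simp: disjoint_iff)
    qed simp
    then have "f x $ k = 0" unfolding fe by (simp add: sum.neutral)
    moreover have "0 < x $ k"
      using k by (smt (verit) divide_pos_pos of_nat_0_less_iff zero_less_card_finite)
    ultimately show "\<exists>k. 0 < x $ k \<and> f x $ k < 1 / CARD('n)" by auto
  qed
  then obtain x where x: "x \<in> ?\<Delta>" "\<And>i. f x $ i = 1 / CARD('n)" by blast
  from coords[OF x(1)] obtain K u where K: "K \<in> \<T>"
    and u: "\<And>v. v \<in> V K \<Longrightarrow> 0 \<le> u v" "sum u (V K) = 1"
    and fe: "f x = (\<Sum>v\<in>V K. u v *\<^sub>R g v)"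
    by blast
  \<comment> \<open>Multiplication by \<open>m\<close> undoes the averaging in
    \<open>g\<close>.\<close>
  have "(\<Sum>j=1..m. \<Sum>v | v \<in> V K \<and> l j v = i. u v) = m / CARD('n)" for i
  proof -
    have "(\<Sum>j=1..m. \<Sum>v | v \<in> V K \<and> l j v = i. u v) = (\<Sum>j=1..m. \<Sum>v\<in>V K. u v * of_bool (l j v = i))"
      using V(1)[OF K] by (intro sum.cong refl sum.mono_neutral_cong_left) auto
    also have "\<dots> = m * (f x $ i)"
      using m unfolding fe g_def
      by (subst sum.swap) (simp add: mult.commute sum_distrib_left)
    finally show ?thesis using x(2) by simp
  qed
  then show ?thesis using K u unfolding V_def by auto
qed

section \<open>Envy-free division with one unknown roommate\<close>

theorem theorem1:
  fixes P :: "nat \<Rightarrow> real ^ 'n::finite \<Rightarrow> 'n set" and \<epsilon> :: real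
  assumes "2 \<le> CARD('n)"
    and "\<And>j x. j \<in> {1..CARD('n) - 1} \<Longrightarrow> x \<in> rent_divisions \<Longrightarrow> P j x \<noteq> {}"
    and "\<And>j x. j \<in> {1..CARD('n) - 1} \<Longrightarrow> x \<in> rent_divisions \<Longrightarrow> (\<exists>i. x $ i = 0) \<Longrightarrow>
           P j x = {i. x $ i = 0}"
    and "\<epsilon> > 0"
  shows "\<exists>S. finite S \<and> S \<subseteq> rent_divisions \<and> diameter S < \<epsilon> \<and>
           (\<exists>\<T> K. triangulates \<T> (rent_divisions :: (real ^ 'n) set) \<and> K \<in> \<T> \<and>
                  S = {v. v extreme_point_of K}) \<and>
           (\<forall>r. \<exists>\<phi>. bij_betw \<phi> {1..CARD('n) - 1} (UNIV - {r}) \<and>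
                  (\<forall>j \<in> {1..CARD('n) - 1}. \<exists>y \<in> S. \<phi> j \<in> P j y))"
proof -
  let ?\<Delta> = "rent_divisions :: (real ^ 'n) set"
  define m where "m = CARD('n) - 1"
  have m: "0 < m" "CARD('n) = Suc m" using assms(1) unfolding m_def by auto
  \<comment> \<open>The bound \<open>\<epsilon>\<close> is for the diameter of \<open>S\<close>, the
    bound 1/n for \<open>ex_balanced_simplex\<close>.\<close>
  have "0 < min \<epsilon> (1 / CARD('n))" using assms(4) by simp
  then obtain \<T> where T: "simplicial_complex \<T>" "\<Union>\<T> = ?\<Delta>"
    and diam: "\<And>K. K \<in> \<T> \<Longrightarrow> diameter K < min \<epsilon> (1 / CARD('n))"
    using fine_simplicial_subdivision_of_cell_complex[of "min \<epsilon> (1 / CARD('n))" "{?\<Delta>}"]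
      polytope_rent_divisions polytope_imp_convex face_of_refl
    by (metis Int_absorb ccpo_Sup_singleton finite.emptyI finite_insert singletonD)
  define l where "l j v = (SOME i. i \<in> P j v)" for j v
  have l: "l j v \<in> P j v" if "j \<in> {1..m}" "v \<in> ?\<Delta>" for j v
    using assms(2) that unfolding l_def m_def by (subst some_in_eq) blast
  have "v $ l j v = 0" if "j \<in> {1..m}" "v \<in> ?\<Delta>" "\<exists>i. v $ i = 0" for j v
    using l[OF that(1,2)] assms(3)[of j v] that unfolding m_def by simp
  with ex_balanced_simplex[OF T _ m(1), of l] diam obtain K u where K: "K \<in> \<T>"
    and u: "\<And>v. v extreme_point_of K \<Longrightarrow> 0 \<le> u v" "sum u {v. v extreme_point_of K} = 1"
    and bal: "\<And>i. (\<Sum>j=1..m. \<Sum>v | v extreme_point_of K \<and> l j v = i. u v) = m / CARD('n)"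
    by fastforce
  define S where "S = {v. v extreme_point_of K}"
  note u = u[folded S_def]
  have S: "finite S" "K = convex hull S"
    using simplicial_complex_simplex[OF T(1) K] unfolding S_def by auto
  have SK: "S \<subseteq> K" "K \<subseteq> ?\<Delta>"
    using K T(2) unfolding S_def extreme_point_of_def by auto
  have "bounded K" unfolding S(2) using S(1) by (simp add: bounded_convex_hull finite_imp_bounded)
  then have diamS: "diameter S < \<epsilon>"
    using diameter_subset[OF SK(1)] diam[OF K] by linarith
  \<comment> \<open>This is the weight matrix: the entry for roommate \<open>j\<close> and room
    \<open>i\<close> is the total weight of the vertices at which \<open>j\<close> picks
    \<open>i\<close>.\<close>
  define w where "w j i = (\<Sum>v | v \<in> S \<and> l j v = i. u v)" for j i
  have w_nonneg: "0 \<le> w j i" for j i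
    unfolding w_def using u(1) S_def by (auto intro: sum_nonneg)
  define N where "N j = (\<Union>v\<in>S. P j v)" for j
  \<comment> \<open>Every vertex has exactly one label, and it lies in \<open>N j\<close>; grouping
    the vertices by label therefore exhausts the total weight 1.\<close>
  have w_sum: "(\<Sum>i\<in>N j. w j i) = 1" if "j \<in> {1..m}" for j
    unfolding w_def u(2)[symmetric]
    by (rule sum.group) (use S(1) l[OF that] SK in \<open>auto simp: N_def\<close>)
  \<comment> \<open>Double counting: the columns of \<open>J\<close> have total weight
    \<open>card J\<close>, all of it in the rows acceptable to someone in \<open>J\<close>, and each
    row sums to m/(m+1). As this is below 1 and \<open>J\<close> is nonempty, the rows outnumber
    \<open>J\<close>.\<close>
  have expand: "card J < card (\<Union>(N ` J))" if J: "J \<subseteq> {1..m}" "J \<noteq> {}" for J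
  proof -
    have "finite J" using J(1) finite_subset by blast
    have "real (card J) = (\<Sum>j\<in>J. \<Sum>i\<in>N j. w j i)"
      using w_sum J(1) by (simp add: subset_iff)
    also have "\<dots> \<le> (\<Sum>j\<in>J. \<Sum>i\<in>\<Union>(N ` J). w j i)"
      by (intro sum_mono sum_mono2) (auto simp: w_nonneg)
    also have "\<dots> \<le> (\<Sum>j=1..m. \<Sum>i\<in>\<Union>(N ` J). w j i)"
      using J(1) by (intro sum_mono2) (auto simp: w_nonneg sum_nonneg)
    also have "\<dots> = (\<Sum>i\<in>\<Union>(N ` J). \<Sum>j=1..m. w j i)" by (rule sum.swap)
    also have "\<dots> = card (\<Union>(N ` J)) * (m / CARD('n))"
      using bal unfolding w_def S_def by simp
    finally have "card J * (real m + 1) \<le> card (\<Union>(N ` J)) * real m"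
      unfolding m(2) by (simp add: field_simps)
    moreover have "0 < card J" using J(2) \<open>finite J\<close> by (simp add: card_gt_0_iff)
    ultimately have "real (card J) * real m < real (card (\<Union>(N ` J))) * real m"
      by (simp add: distrib_left)
    then show ?thesis using m(1) by simp
  qed
  have "\<exists>\<phi>. bij_betw \<phi> {1..m} (UNIV - {r}) \<and> (\<forall>j\<in>{1..m}. \<exists>y\<in>S. \<phi> j \<in> P j y)" for r
  proof -
    \<comment> \<open>The strict inequality in \<open>expand\<close> leaves room for the loss of
      \<open>r\<close>.\<close>
    have "card J \<le> card (\<Union>((\<lambda>j. N j - {r}) ` J))" if J: "J \<subseteq> {1..m}" for J
    proof (cases "J = {}")
      case False
      have "\<Union>((\<lambda>j. N j - {r}) ` J) = \<Union>(N ` J) - {r}" by auto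
      then show ?thesis
        using expand[OF J False] diff_card_le_card_Diff[of "{r}" "\<Union>(N ` J)"] by simp
    qed simp
    then obtain \<phi> where \<phi>: "inj_on \<phi> {1..m}" "\<And>j. j \<in> {1..m} \<Longrightarrow> \<phi> j \<in> N j - {r}"
      using Hall_marriage[of "{1..m}" "\<lambda>j. N j - {r}"] by auto
    \<comment> \<open>Removing \<open>r\<close> leaves exactly \<open>m\<close> rooms, so the
      injective choice is onto.\<close>
    have "\<phi> ` {1..m} = UNIV - {r}"
    proof (rule card_subset_eq)
      show "\<phi> ` {1..m} \<subseteq> UNIV - {r}" using \<phi>(2) by blast
      show "card (\<phi> ` {1..m}) = card (UNIV - {r})"
        using \<phi>(1) m(2) by (simp add: card_image card_Diff_singleton)
    qed simp
    then show ?thesis using \<phi> unfolding bij_betw_def N_def by blast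
  qed
  then show ?thesis
    using S(1) SK diamS T K unfolding triangulates_def m_def S_def by blast
qed

end
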